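(* Let $n \ge 2$, let $s$ be a nonzero integer and $m$ an integer. Then the Diophantine equation $$ \left(\frac{1}{x_1} + \frac{1}{x_2} + \cdots + \frac{1}{x_n}\right) - \frac{s}{x_1 x_2 \cdots x_n} = m $$ has infinitely many solutions in nonzero integers $(x_1,\dots,x_n)$ if and only if one of the following holds: (i) $|m| \le n-2$ (with $s$ arbitrary); (ii) $m = n-1$ and $s = 1$; or (iii) $m = -(n-1)$ and $s = (-1)^{n-1}$. *)

theory Defs
  imports Complex_Main "HOL-Library.FuncSet"
begin

text \<open>Integer \<open>n\<close>-tuples are extensional functions on \<open>{1..n}\<close>. Extensionality makes functions
  agreeing on \<open>{1..n}\<close> equal, so that infinitely many functions means infinitely many tuples.\<close>

definition nonzero_solutions :: "nat \<Rightarrow> int \<Rightarrow> int \<Rightarrow> (nat \<Rightarrow> int) set" where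
  "nonzero_solutions n s m =
     {x \<in> {1..n} \<rightarrow>\<^sub>E (UNIV - {0}).
        (\<Sum>i=1..n. 1 / rat_of_int (x i)) - rat_of_int s / (\<Prod>i=1..n. rat_of_int (x i))
          = rat_of_int m}"

end

theory Submission
  imports Defs
begin

text \<open>An entry \<open>e = 1\<close> or \<open>e = -1\<close> can be appended to a solution for \<open>(n, s, m)\<close>, giving one for
  \<open>(n + 1, e s, m + e)\<close>; with the explicit families for \<open>n \<le> 3\<close> this yields all infinite cases.
  Conversely, negating all entries lets us assume \<open>m \<ge> n - 1\<close>. Then the nonnegative numbers
  \<open>1 - 1 / x\<^sub>i\<close> sum to at most \<open>1 - s / P\<close>, where \<open>P\<close> is the product of the entries. Each entry other
  than \<open>1\<close> contributes at least \<open>1/2\<close>, so two of them already bound \<open>P\<close>, unless both are \<open>2\<close>; with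
  one such entry, that entry divides \<open>1 - s\<close>.\<close>

section \<open>Membership, appending a unit entry, and negation\<close>

lemma nonzero_solutionsI:
  assumes "\<And>i. i \<in> {1..n} \<Longrightarrow> x i \<noteq> 0" and "\<And>i. i \<notin> {1..n} \<Longrightarrow> x i = undefined"
    and "(\<Sum>i=1..n. 1 / rat_of_int (x i)) - rat_of_int s / (\<Prod>i=1..n. rat_of_int (x i))
      = rat_of_int m"
  shows "x \<in> nonzero_solutions n s m"
  using assms unfolding nonzero_solutions_def by (auto simp: PiE_iff extensional_def)

lemma nonzero_solutionsD:
  assumes "x \<in> nonzero_solutions n s m"
  shows "i \<in> {1..n} \<Longrightarrow> x i \<noteq> 0" and "i \<notin> {1..n} \<Longrightarrow> x i = undefined"
    and "(\<Sum>i=1..n. 1 / rat_of_int (x i)) - rat_of_int s / (\<Prod>i=1..n. rat_of_int (x i))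
      = rat_of_int m"
  using assms unfolding nonzero_solutions_def by (auto simp: PiE_iff extensional_def)

text \<open>Since \<open>1 / e = e\<close>, the sum grows by \<open>e\<close>, while the factor
  \<open>e\<close> in the numerator cancels the one in the product.\<close>

lemma infinite_nonzero_solutions_append:
  assumes inf: "infinite (nonzero_solutions n s m)" and e: "e = 1 \<or> e = -1"
  shows "infinite (nonzero_solutions (Suc n) (e * s) (m + e))"
proof -
  let ?f = "\<lambda>x :: nat \<Rightarrow> int. x(Suc n := e)"
  have "inj_on ?f (nonzero_solutions n s m)"
  proof (rule inj_onI)
    fix x y
    assume x: "x \<in> nonzero_solutions n s m" and y: "y \<in> nonzero_solutions n s m"
      and eq: "?f x = ?f y"
    show "x = y"
    proof
      fix i
      \<comment> \<open>The update erases the values at \<open>Suc n\<close>, but extensionality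
        makes both of them \<open>undefined\<close>.\<close>
      show "x i = y i"
        using nonzero_solutionsD(2)[OF x, of i] nonzero_solutionsD(2)[OF y, of i] fun_cong[OF eq, of i]
        by (cases "i = Suc n") auto
    qed
  qed
  moreover have "?f ` nonzero_solutions n s m \<subseteq> nonzero_solutions (Suc n) (e * s) (m + e)"
  proof
    fix z assume "z \<in> ?f ` nonzero_solutions n s m"
    then obtain x where x: "x \<in> nonzero_solutions n s m" and z: "z = ?f x"
      by blast
    note xD = nonzero_solutionsD[OF x]
    have S: "(\<Sum>i=1..n. 1 / rat_of_int (z i)) = (\<Sum>i=1..n. 1 / rat_of_int (x i))"
      unfolding z by (rule sum.cong) auto
    have P: "(\<Prod>i=1..n. rat_of_int (z i)) = (\<Prod>i=1..n. rat_of_int (x i))"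
      unfolding z by (rule prod.cong) auto
    have ze: "z (Suc n) = e"
      by (simp add: z)
    show "z \<in> nonzero_solutions (Suc n) (e * s) (m + e)"
    proof (rule nonzero_solutionsI)
      show "z i \<noteq> 0" if "i \<in> {1..Suc n}" for i
        using that xD(1)[of i] e by (auto simp: z)
      show "z i = undefined" if "i \<notin> {1..Suc n}" for i
        using that xD(2)[of i] by (auto simp: z)
      show "(\<Sum>i=1..Suc n. 1 / rat_of_int (z i))
          - rat_of_int (e * s) / (\<Prod>i=1..Suc n. rat_of_int (z i)) = rat_of_int (m + e)"
        using xD(3) e by (auto simp: S P ze simp del: One_nat_def)
    qed
  qed
  ultimately show ?thesis
    using inf finite_imageD finite_subset by blast
qed

text \<open>The product gains \<open>(-1) ^ n\<close>, so the numerator needs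
  \<open>(-1) ^ (n - 1)\<close> for the quotient to change sign along with the sum.\<close>

lemma infinite_nonzero_solutions_negate:
  assumes inf: "infinite (nonzero_solutions n s m)" and n: "n \<ge> 1"
  shows "infinite (nonzero_solutions n ((-1) ^ (n - 1) * s) (- m))"
proof -
  let ?f = "\<lambda>x :: nat \<Rightarrow> int. restrict (\<lambda>i. - x i) {1..n}"
  have "inj_on ?f (nonzero_solutions n s m)"
  proof (rule inj_onI)
    fix x y
    assume x: "x \<in> nonzero_solutions n s m" and y: "y \<in> nonzero_solutions n s m"
      and eq: "?f x = ?f y"
    show "x = y"
    proof
      fix i
      show "x i = y i"
        using nonzero_solutionsD(2)[OF x, of i] nonzero_solutionsD(2)[OF y, of i] fun_cong[OF eq, of i]
        by (cases "i \<in> {1..n}") auto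
    qed
  qed
  moreover have "?f ` nonzero_solutions n s m \<subseteq> nonzero_solutions n ((-1) ^ (n - 1) * s) (- m)"
  proof
    fix z assume "z \<in> ?f ` nonzero_solutions n s m"
    then obtain x where x: "x \<in> nonzero_solutions n s m" and z: "z = ?f x"
      by blast
    note xD = nonzero_solutionsD[OF x]
    have S: "(\<Sum>i=1..n. 1 / rat_of_int (z i)) = - (\<Sum>i=1..n. 1 / rat_of_int (x i))"
      unfolding z sum_negf[symmetric] by (rule sum.cong) auto
    have "(\<Prod>i=1..n. rat_of_int (z i)) = (\<Prod>i=1..n. (-1) * rat_of_int (x i))"
      unfolding z by (rule prod.cong) auto
    also have "\<dots> = (-1) ^ n * (\<Prod>i=1..n. rat_of_int (x i))"
      by (subst prod.distrib) simp
    finally have P: "(\<Prod>i=1..n. rat_of_int (z i)) = (-1) ^ n * (\<Prod>i=1..n. rat_of_int (x i))" .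
    obtain k where k: "n = Suc k"
      using n by (cases n) auto
    have Q: "rat_of_int ((-1) ^ (n - 1) * s) / ((-1) ^ n * p) = - (rat_of_int s / p)" for p
      by (cases "even k") (simp_all add: k)
    show "z \<in> nonzero_solutions n ((-1) ^ (n - 1) * s) (- m)"
    proof (rule nonzero_solutionsI)
      show "z i \<noteq> 0" if "i \<in> {1..n}" for i
        using that xD(1)[of i] by (auto simp: z)
      show "z i = undefined" if "i \<notin> {1..n}" for i
        using that by (auto simp: z)
      show "(\<Sum>i=1..n. 1 / rat_of_int (z i))
          - rat_of_int ((-1) ^ (n - 1) * s) / (\<Prod>i=1..n. rat_of_int (z i)) = rat_of_int (- m)"
        unfolding S P Q using xD(3) by simp
    qed
  qed
  ultimately show ?thesis
    using inf finite_imageD finite_subset by blast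
qed

section \<open>Explicit families for n = 1, 2, 3\<close>

lemma infinite_nonzero_solutions_if_first_entries:
  assumes "\<And>t. t > c \<Longrightarrow> \<exists>x \<in> nonzero_solutions n s m. x 1 = t"
  shows "infinite (nonzero_solutions n s m)"
proof
  assume "finite (nonzero_solutions n s m)"
  then have "finite ((\<lambda>x. x 1) ` nonzero_solutions n s m)"
    by simp
  moreover have "{c<..} \<subseteq> (\<lambda>x. x 1) ` nonzero_solutions n s m"
    using assms by force
  ultimately show False
    using infinite_Ioi[of c] finite_subset by blast
qed

lemma infinite_nonzero_solutions_1: "infinite (nonzero_solutions 1 1 0)"
proof (rule infinite_nonzero_solutions_if_first_entries[where c = 0])
  fix t :: int assume "t > 0"
  then show "\<exists>x \<in> nonzero_solutions 1 1 0. x 1 = t"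
    by (intro bexI[of _ "(\<lambda>_. undefined)(1 := t)"] nonzero_solutionsI) auto
qed

text \<open>For \<open>m = 0\<close> the equation reads \<open>x 1 + x 2 = s\<close>. Taking
  \<open>t > \<bar>s\<bar>\<close> keeps both \<open>t\<close> and \<open>s - t\<close>
  nonzero.\<close>

lemma infinite_nonzero_solutions_2: "infinite (nonzero_solutions 2 s 0)"
proof (rule infinite_nonzero_solutions_if_first_entries[where c = "\<bar>s\<bar>"])
  fix t :: int assume t: "t > \<bar>s\<bar>"
  have I: "{Suc 0..2} = {Suc 0, 2}"
    by auto
  have "t \<noteq> 0" "s - t \<noteq> 0"
    using t by auto
  then have nz: "rat_of_int t \<noteq> 0" "rat_of_int (s - t) \<noteq> 0"
    by (simp_all only: of_int_eq_0_iff not_False_eq_True)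
  have eq: "1 / rat_of_int t + 1 / rat_of_int (s - t)
      - rat_of_int s / (rat_of_int t * rat_of_int (s - t)) = 0"
    using nz by (simp add: field_simps)
  show "\<exists>x \<in> nonzero_solutions 2 s 0. x 1 = t"
  proof (intro bexI[of _ "(\<lambda>_. undefined)(1 := t, 2 := s - t)"] nonzero_solutionsI)
  qed (use t eq in \<open>auto simp: I\<close>)
qed

text \<open>With \<open>x\<^sub>1 + x\<^sub>2 = 1\<close> the equation \<open>x\<^sub>1 x\<^sub>2 + x\<^sub>1 x\<^sub>3 + x\<^sub>2 x\<^sub>3 = s\<close> becomes linear in \<open>x\<^sub>3\<close>.\<close>

lemma infinite_nonzero_solutions_3: "infinite (nonzero_solutions 3 s 0)"
proof (rule infinite_nonzero_solutions_if_first_entries[where c = "\<bar>s\<bar> + 1"])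
  fix t :: int assume t: "t > \<bar>s\<bar> + 1"
  define u where "u = s - t + t * t"
  \<comment> \<open>Here \<open>u = s + t * (t - 1)\<close>, so this estimate and
    \<open>t > \<bar>s\<bar>\<close> make \<open>u\<close> positive.\<close>
  have "t * 1 \<le> t * (t - 1)"
    using t by (intro mult_left_mono) auto
  then have u: "u > 0"
    using t by (simp add: u_def algebra_simps)
  have I: "{Suc 0..3} = {Suc 0, 2, 3}"
    by auto
  have "t \<noteq> 0" "1 - t \<noteq> 0" "u \<noteq> 0"
    using t u by auto
  then have nz: "rat_of_int t \<noteq> 0" "rat_of_int (1 - t) \<noteq> 0" "rat_of_int u \<noteq> 0"
    by (simp_all only: of_int_eq_0_iff not_False_eq_True)
  have s: "s = t * (1 - t) + t * u + (1 - t) * u"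
    by (simp add: u_def algebra_simps)
  have eq: "1 / rat_of_int t + (1 / rat_of_int (1 - t) + 1 / rat_of_int u)
      - rat_of_int s / (rat_of_int t * (rat_of_int (1 - t) * rat_of_int u)) = 0"
    using nz unfolding s of_int_add of_int_mult
    by (simp add: divide_simps del: of_int_diff) (simp add: algebra_simps)
  show "\<exists>x \<in> nonzero_solutions 3 s 0. x 1 = t"
  proof (intro bexI[of _ "(\<lambda>_. undefined)(1 := t, 2 := 1 - t, 3 := u)"] nonzero_solutionsI)
  qed (use t u eq in \<open>auto simp: I\<close>)
qed

section \<open>The infinite cases for general n\<close>

lemma infinite_nonzero_solutions_small:
  assumes "n \<ge> 2" and "\<bar>m\<bar> \<le> int n - 2"
  shows "infinite (nonzero_solutions n s m)"
  using assms
proof (induction n arbitrary: s m rule: dec_induct)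
  case base
  then show ?case
    using infinite_nonzero_solutions_2 by simp
next
  case (step k)
  show ?case
  \<comment> \<open>Removing an entry \<open>e\<close> with the sign of \<open>m\<close> lowers the
    absolute value of \<open>m\<close>. For \<open>m = 0\<close> it becomes 1 instead, which is
    allowed only if \<open>k \<ge> 3\<close>; hence the separate family for three entries.\<close>
  proof (cases "k = 2 \<and> m = 0")
    case True
    then show ?thesis
      using infinite_nonzero_solutions_3[of s] by (simp add: numeral_3_eq_3)
  next
    case False
    define e :: int where "e = (if m \<ge> 1 then 1 else -1)"
    have "\<bar>m - e\<bar> \<le> int k - 2"
      using step.prems step.hyps False by (auto simp: e_def)
    then have "infinite (nonzero_solutions (Suc k) (e * (e * s)) (m - e + e))"
      by (intro infinite_nonzero_solutions_append step.IH) (auto simp: e_def)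
    then show ?thesis
      by (simp add: e_def split: if_splits)
  qed
qed

text \<open>Append \<open>k\<close> copies of \<open>e\<close> to the one-entry family. The two
  signs of \<open>e\<close> give cases (ii) and (iii).\<close>

lemma infinite_nonzero_solutions_extremal:
  assumes "e = 1 \<or> e = -1"
  shows "infinite (nonzero_solutions (Suc k) (e ^ k) (int k * e))"
proof (induction k)
  case 0
  then show ?case
    using infinite_nonzero_solutions_1 by simp
next
  case (Suc k)
  from infinite_nonzero_solutions_append[OF this assms] show ?case
    by (simp add: algebra_simps)
qed

section \<open>Finiteness for m at least n - 1\<close>

lemma one_minus_inverse_of_int_lower_bounds:
  fixes a :: int
  assumes "a \<noteq> 0"
  shows "0 \<le> 1 - 1 / rat_of_int a"
    and "a \<noteq> 1 \<Longrightarrow> 1 / 2 \<le> 1 - 1 / rat_of_int a"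
    and "a \<noteq> 1 \<Longrightarrow> a \<noteq> 2 \<Longrightarrow> 2 / 3 \<le> 1 - 1 / rat_of_int a"
proof -
  \<comment> \<open>The three bounds are the instances \<open>b = 1, 2, 3\<close>. The third matters
    because two entries 2 contribute exactly 1, whereas \<open>1 / 2 + 2 / 3 = 7 / 6\<close> exceeds
    1.\<close>
  have *: "1 / rat_of_int a \<le> 1 / rat_of_int b" if "b > 0" "a < 0 \<or> a \<ge> b" for b
  proof (cases "a < 0")
    case True
    then have "1 / rat_of_int a < 0"
      by simp
    also have "0 < 1 / rat_of_int b"
      using that by simp
    finally show ?thesis
      by simp
  next
    case False
    then show ?thesis
      using that by (intro divide_left_mono) auto
  qed
  show "0 \<le> 1 - 1 / rat_of_int a"
    using *[of 1] assms by force
  show "1 / 2 \<le> 1 - 1 / rat_of_int a" if "a \<noteq> 1"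
    using *[of 2] assms that by force
  show "2 / 3 \<le> 1 - 1 / rat_of_int a" if "a \<noteq> 1" "a \<noteq> 2"
    using *[of 3] assms that by force
qed

lemma abs_prod_le:
  assumes x: "x \<in> nonzero_solutions n s m" and m: "m \<ge> int n - 1"
    and not_extremal: "\<not> (m = int n - 1 \<and> s = 1)"
  shows "\<bar>\<Prod>i=1..n. x i\<bar> \<le> 6 * \<bar>s\<bar> + 4"
proof -
  note xD = nonzero_solutionsD[OF x]
  define P where "P = (\<Prod>i=1..n. x i)"
  \<comment> \<open>Entries 1 contribute a factor 1 to \<open>P\<close> and 0 to the sum of
    \<open>g\<close>, so both live on \<open>K\<close>.\<close>
  define K where "K = {i \<in> {1..n}. x i \<noteq> 1}"
  define g where "g i = 1 - 1 / rat_of_int (x i)" for i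
  have K: "finite K" "K \<subseteq> {1..n}"
    by (auto simp: K_def)
  have P0: "P \<noteq> 0"
    using xD(1) by (auto simp: P_def)
  have PK: "P = prod x K"
    unfolding P_def by (rule prod.mono_neutral_right) (auto simp: K_def)
  have "(\<Sum>i=1..n. g i) = rat_of_int (int n - m) - rat_of_int s / rat_of_int P"
    using xD(3) by (simp add: g_def sum_subtractf P_def algebra_simps)
  moreover have "(\<Sum>i=1..n. g i) = sum g K"
    by (rule sum.mono_neutral_right) (auto simp: K_def g_def)
  ultimately have sumK: "sum g K = rat_of_int (int n - m) - rat_of_int s / rat_of_int P"
    by simp
  \<comment> \<open>As \<open>int n - m \<le> 1\<close>, the excess \<open>7 / 6 - 1 = 1 / 6\<close>
    must come from \<open>- s / P\<close>, whence the factor 6.\<close>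
  have bound: "\<bar>P\<bar> \<le> 6 * \<bar>s\<bar> + 4" if "sum g K \<ge> 7 / 6"
  proof -
    have "rat_of_int (int n - m) \<le> rat_of_int 1"
      using m by (subst of_int_le_iff) simp
    then have "1 / 6 \<le> - (rat_of_int s / rat_of_int P)"
      using sumK that by simp
    also have "\<dots> \<le> rat_of_int \<bar>s\<bar> / rat_of_int \<bar>P\<bar>"
      by (metis abs_divide abs_ge_minus_self of_int_abs)
    finally have "rat_of_int \<bar>P\<bar> \<le> rat_of_int (6 * \<bar>s\<bar>)"
      using P0 by (simp add: field_simps)
    then show ?thesis
      by (subst (asm) of_int_le_iff) simp
  qed
  have g: "0 \<le> g i" "1 / 2 \<le> g i" "x i \<noteq> 2 \<Longrightarrow> 2 / 3 \<le> g i" if "i \<in> K" for i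
    using that one_minus_inverse_of_int_lower_bounds[of "x i"] xD(1)[of i]
    by (auto simp: K_def g_def)
  have subK: "sum g L \<le> sum g K" if "L \<subseteq> K" for L
    using that K g(1) by (intro sum_mono2) auto
  consider "K = {}" | a where "K = {a}"
    | a b where "a \<in> K" "b \<in> K" "a \<noteq> b" "K \<subseteq> {a, b}"
    | a b c where "{a, b, c} \<subseteq> K" "a \<noteq> b" "c \<notin> {a, b}"
    by blast
  then have "\<bar>P\<bar> \<le> 6 * \<bar>s\<bar> + 4"
  proof cases
    case 1
    then show ?thesis
      by (simp add: PK)
  next
    case (2 a)
    then have Pa: "P = x a"
      by (simp add: PK)
    have "1 - 1 / rat_of_int P = rat_of_int (int n - m) - rat_of_int s / rat_of_int P"
      using sumK by (simp add: 2 g_def Pa)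
    then have "rat_of_int (P * (1 - (int n - m))) = rat_of_int (1 - s)"
      using P0 by (simp add: field_simps)
    then have eq: "P * (1 - (int n - m)) = 1 - s"
      by (subst (asm) of_int_eq_iff)
    \<comment> \<open>If \<open>s = 1\<close>, then \<open>P \<noteq> 0\<close> forces
      \<open>m = int n - 1\<close>, the excluded case. So \<open>P\<close> divides a nonzero
      number.\<close>
    then have "s \<noteq> 1"
      using P0 not_extremal by auto
    moreover have "P dvd 1 - s"
      using eq by (metis dvd_triv_left)
    ultimately have "\<bar>P\<bar> \<le> \<bar>1 - s\<bar>"
      by (intro dvd_imp_le_int) auto
    then show ?thesis
      by linarith
  next
    case (3 a b)
    then have Kab: "K = {a, b}"
      by auto
    show ?thesis
    proof (cases "x a = 2 \<and> x b = 2")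
      case True
      \<comment> \<open>Here \<open>P = 4\<close>, which accounts for the summand 4 in the
        bound.\<close>
      then show ?thesis
        using 3 by (simp add: PK Kab)
    next
      case False
      then have "7 / 6 \<le> g a + g b"
        using g(2)[of a] g(2)[of b] g(3)[of a] g(3)[of b] 3 by force
      then show ?thesis
        using 3 by (intro bound) (simp add: Kab)
    qed
  next
    case (4 a b c)
    \<comment> \<open>Three contributions of at least \<open>1 / 2\<close> give
      \<open>3 / 2\<close>.\<close>
    then have "7 / 6 \<le> sum g {a, b, c}"
      using g(2)[of a] g(2)[of b] g(2)[of c] by simp
    then show ?thesis
      using subK[OF 4(1)] by (intro bound) linarith
  qed
  then show ?thesis
    by (simp add: P_def)
qed

lemma finite_nonzero_solutions:
  assumes "m \<ge> int n - 1" and "\<not> (m = int n - 1 \<and> s = 1)"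
  shows "finite (nonzero_solutions n s m)"
proof (rule finite_subset)
  define C where "C = 6 * \<bar>s\<bar> + 4"
  show "nonzero_solutions n s m \<subseteq> {1..n} \<rightarrow>\<^sub>E {-C..C}"
  proof
    fix x assume x: "x \<in> nonzero_solutions n s m"
    note xD = nonzero_solutionsD[OF x]
    have "x i \<in> {-C..C}" if i: "i \<in> {1..n}" for i
    proof -
      \<comment> \<open>Each entry divides the nonzero product, so a bound on the product confines
        all entries to a finite box.\<close>
      have "\<bar>x i\<bar> \<le> \<bar>\<Prod>i=1..n. x i\<bar>"
        using i xD(1) by (intro dvd_imp_le_int dvd_prodI) auto
      also have "\<dots> \<le> C"
        unfolding C_def by (rule abs_prod_le[OF x assms])
      finally show ?thesis
        by auto
    qed
    then show "x \<in> {1..n} \<rightarrow>\<^sub>E {-C..C}"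
      using xD(2) by (auto simp: PiE_iff extensional_def)
  qed
  show "finite ({1..n} \<rightarrow>\<^sub>E {-C..C})"
    by (intro finite_PiE) auto
qed

theorem theorem6p1:
  fixes n :: nat and s m :: int
  assumes "n \<ge> 2" and "s \<noteq> 0"
  shows "infinite (nonzero_solutions n s m) \<longleftrightarrow>
    \<bar>m\<bar> \<le> int n - 2 \<or>
    (m = int n - 1 \<and> s = 1) \<or>
    (m = - (int n - 1) \<and> s = (-1) ^ (n - 1))"
proof
  assume inf: "infinite (nonzero_solutions n s m)"
  have neg: "infinite (nonzero_solutions n ((-1) ^ (n - 1) * s) (- m))"
    using infinite_nonzero_solutions_negate[OF inf] assms(1) by simp
  have pos_case: "m = int n - 1 \<and> s = 1" if "m \<ge> int n - 1"
    using finite_nonzero_solutions[OF that, of s] inf by blast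
  \<comment> \<open>The finiteness result covers only large \<open>m\<close>; the negated solutions
    handle \<open>m \<le> - (int n - 1)\<close>.\<close>
  have neg_case: "- m = int n - 1 \<and> (-1) ^ (n - 1) * s = 1" if "- m \<ge> int n - 1"
    using finite_nonzero_solutions[OF that] neg by blast
  have "s = (-1) ^ (n - 1)" if "(-1) ^ (n - 1) * s = 1"
    using that by (cases "even (n - 1)") auto
  then show "\<bar>m\<bar> \<le> int n - 2 \<or> (m = int n - 1 \<and> s = 1) \<or>
      (m = - (int n - 1) \<and> s = (-1) ^ (n - 1))"
    using pos_case neg_case by linarith
next
  have "Suc (n - 1) = n" "int (n - 1) = int n - 1"
    using assms(1) by auto
  then have "infinite (nonzero_solutions n (e ^ (n - 1)) ((int n - 1) * e))" if "e = 1 \<or> e = -1" for e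
    using infinite_nonzero_solutions_extremal[OF that, of "n - 1"] by simp
  from this[of 1] this[of "-1"]
  have "infinite (nonzero_solutions n 1 (int n - 1))"
    "infinite (nonzero_solutions n ((-1) ^ (n - 1)) (- (int n - 1)))"
    by simp_all
  moreover assume "\<bar>m\<bar> \<le> int n - 2 \<or> (m = int n - 1 \<and> s = 1) \<or>
      (m = - (int n - 1) \<and> s = (-1) ^ (n - 1))"
  ultimately show "infinite (nonzero_solutions n s m)"
    using infinite_nonzero_solutions_small[OF assms(1)] by blast
qed

end
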